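(* Let $\mathcal{F}(\lambda,\rho)$ be the fixed-form ELBO and $\mathcal{L}(\lambda)$ the locally maximised ELBO (LM-ELBO) defined in the context, and for each $\lambda$ let $\rho^*(\lambda)$ be a parameter value with $q(\theta;\rho^*(\lambda))=q^*_\lambda(\theta)$. Then for every $\lambda\in\Lambda$, $$\mathcal{L}(\lambda)=\mathcal{F}(\lambda,\rho^*(\lambda))\qquad\text{and}\qquad \mathcal{L}(\lambda)=\max_{\rho\in\mathcal{R}}\mathcal{F}(\lambda,\rho).$$
   Context: Setting. $X$ and $\theta$ are (multivariate) unknown variables and $Y$ is a fixed observation. $f(X,\theta,Y)\ge 0$ is an unnormalised posterior density, $p(X,\theta|Y)\propto f(X,\theta,Y)$. Densities of $X$ and of $\theta$ are taken with respect to fixed $\sigma$-finite reference measures (Lebesgue or counting measure). $\{q(X;\lambda):\lambda\in\Lambda\}$ and $\{q(\theta;\rho):\rho\in\mathcal{R}\}$ are parametric families of probability densities, with $\Lambda$ and $\mathcal{R}$ subsets of Euclidean spaces. Fixed-form ELBO: $$\mathcal{F}(\lambda,\rho)=\mathrm{E}_{q(X;\lambda)q(\theta;\rho)}\log\frac{f(X,\theta,Y)}{q(X;\lambda)\,q(\theta;\rho)}.$$ For each $\lambda$ define the probability density $q^*_\lambda(\theta)\propto\exp\big(\mathrm{E}_{q(X;\lambda)}\log f(X,\theta,Y)\big)$ (with $\exp(-\infty)=0$). It is assumed normalisable. LM-ELBO: $$\mathcal{L}(\lambda)=\mathrm{E}_{q(X;\lambda)q^*_\lambda(\theta)}\log\frac{f(X,\theta,Y)}{q(X;\lambda)\,q^*_\lambda(\theta)}.$$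 Standing assumptions: for every $\lambda$ the density $q^*_\lambda$ belongs to the family $\{q(\theta;\rho)\}$, and $\rho^*(\lambda)$ denotes a parameter value with $q(\theta;\rho^*(\lambda))=q^*_\lambda(\theta)$. All the expectations appearing (of $\log f$ under $q(X;\lambda)q(\theta;\rho)$, of $\log q(X;\lambda)$ under $q(X;\lambda)$, and of $\log q(\theta;\rho)$ under $q(\theta;\rho)$) are well defined and finite. *)

theory Defs
  imports "HOL-Probability.Probability"
begin

text \<open>Logarithm and exponential with the conventions \<open>log 0 = -\<infinity>\<close> and \<open>exp (-\<infinity>) = 0\<close>
  (the library has \<open>ln 0 = 0\<close>).\<close>

definition elog :: "real \<Rightarrow> ereal" where
  "elog u = (if u > 0 then ereal (ln u) else -\<infinity>)"

definition eexp :: "ereal \<Rightarrow> ennreal" where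
  "eexp v = (if v = \<infinity> then \<infinity> else if v = -\<infinity> then 0 else ennreal (exp (real_of_ereal v)))"

text \<open>Expectation of an extended-real function as positive part minus negative part. It is
  meaningful only under \<open>expectation_defined\<close>; note that \<open>\<infinity> - \<infinity> = \<infinity>\<close> for \<open>ereal\<close>.\<close>

definition pos_expectation :: "'a measure \<Rightarrow> ('a \<Rightarrow> ereal) \<Rightarrow> ennreal" where
  "pos_expectation P g = (\<integral>\<^sup>+ z. e2ennreal (g z) \<partial>P)"

definition ext_expectation :: "'a measure \<Rightarrow> ('a \<Rightarrow> ereal) \<Rightarrow> ereal" where
  "ext_expectation P g =
     enn2ereal (pos_expectation P g) - enn2ereal (pos_expectation P (\<lambda>z. - g z))"

definition expectation_defined :: "'a measure \<Rightarrow> ('a \<Rightarrow> ereal) \<Rightarrow> bool" where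
  "expectation_defined P g \<longleftrightarrow> g \<in> borel_measurable P \<and>
     (pos_expectation P g < \<infinity> \<or> pos_expectation P (\<lambda>z. - g z) < \<infinity>)"

definition expectation_finite :: "'a measure \<Rightarrow> ('a \<Rightarrow> ereal) \<Rightarrow> bool" where
  "expectation_finite P g \<longleftrightarrow> g \<in> borel_measurable P \<and>
     pos_expectation P g < \<infinity> \<and> pos_expectation P (\<lambda>z. - g z) < \<infinity>"

definition prob_density :: "'a measure \<Rightarrow> ('a \<Rightarrow> real) \<Rightarrow> bool" where
  "prob_density M q \<longleftrightarrow> q \<in> borel_measurable M \<and> (\<forall>x\<in>space M. 0 \<le> q x) \<and>
     (\<integral>\<^sup>+ x. ennreal (q x) \<partial>M) = 1"

definition normalisable :: "'a measure \<Rightarrow> ('a \<Rightarrow> ennreal) \<Rightarrow> bool" where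
  "normalisable M g \<longleftrightarrow> g \<in> borel_measurable M \<and>
     0 < (\<integral>\<^sup>+ x. g x \<partial>M) \<and> (\<integral>\<^sup>+ x. g x \<partial>M) < \<infinity>"

text \<open>The distribution of \<open>(X, \<theta>)\<close> with density \<open>q(X) r(\<theta>)\<close> relative to \<open>M \<Otimes>\<^sub>M N\<close>.\<close>

definition product_law ::
  "'x measure \<Rightarrow> 't measure \<Rightarrow> ('x \<Rightarrow> real) \<Rightarrow> ('t \<Rightarrow> real) \<Rightarrow> ('x \<times> 't) measure" where
  "product_law M N q r = density (M \<Otimes>\<^sub>M N) (\<lambda>(x, t). ennreal (q x * r t))"

text \<open>The ELBO of variational densities \<open>q\<close>, \<open>r\<close>. The ratio may be \<open>0\<close> through division by zero
  only where \<open>q x * r t = 0\<close>, which is a null set of \<open>product_law\<close>.\<close>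

definition elbo ::
  "'x measure \<Rightarrow> 't measure \<Rightarrow> ('x \<Rightarrow> 't \<Rightarrow> real) \<Rightarrow> ('x \<Rightarrow> real) \<Rightarrow> ('t \<Rightarrow> real) \<Rightarrow> ereal" where
  "elbo M N g q r =
     ext_expectation (product_law M N q r) (\<lambda>(x, t). elog (g x t / (q x * r t)))"

definition fixed_form_elbo ::
  "'x measure \<Rightarrow> 't measure \<Rightarrow> ('x \<Rightarrow> 't \<Rightarrow> 'y \<Rightarrow> real) \<Rightarrow> 'y \<Rightarrow> ('l \<Rightarrow> 'x \<Rightarrow> real) \<Rightarrow> ('r \<Rightarrow> 't \<Rightarrow> real)
     \<Rightarrow> 'l \<Rightarrow> 'r \<Rightarrow> ereal" where
  "fixed_form_elbo M N f y qX q\<theta> l \<rho> = elbo M N (\<lambda>x t. f x t y) (qX l) (q\<theta> \<rho>)"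

definition qstar_unnorm ::
  "'x measure \<Rightarrow> ('x \<Rightarrow> 't \<Rightarrow> 'y \<Rightarrow> real) \<Rightarrow> 'y \<Rightarrow> ('l \<Rightarrow> 'x \<Rightarrow> real) \<Rightarrow> 'l \<Rightarrow> 't \<Rightarrow> ennreal" where
  "qstar_unnorm M f y qX l t =
     eexp (ext_expectation (density M (\<lambda>x. ennreal (qX l x))) (\<lambda>x. elog (f x t y)))"

definition qstar ::
  "'x measure \<Rightarrow> 't measure \<Rightarrow> ('x \<Rightarrow> 't \<Rightarrow> 'y \<Rightarrow> real) \<Rightarrow> 'y \<Rightarrow> ('l \<Rightarrow> 'x \<Rightarrow> real)
     \<Rightarrow> 'l \<Rightarrow> 't \<Rightarrow> real" where
  "qstar M N f y qX l t =
     enn2real (qstar_unnorm M f y qX l t / (\<integral>\<^sup>+ s. qstar_unnorm M f y qX l s \<partial>N))"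

definition lm_elbo ::
  "'x measure \<Rightarrow> 't measure \<Rightarrow> ('x \<Rightarrow> 't \<Rightarrow> 'y \<Rightarrow> real) \<Rightarrow> 'y \<Rightarrow> ('l \<Rightarrow> 'x \<Rightarrow> real)
     \<Rightarrow> 'l \<Rightarrow> ereal" where
  "lm_elbo M N f y qX l = elbo M N (\<lambda>x t. f x t y) (qX l) (qstar M N f y qX l)"

definition is_maximum :: "'a::order set \<Rightarrow> 'a \<Rightarrow> bool" where
  "is_maximum S m \<longleftrightarrow> m \<in> S \<and> (\<forall>v\<in>S. v \<le> m)"

end

theory Submission
  imports Defs
begin

text \<open>
  Write \<open>P\<close> for the law of \<open>X\<close>, \<open>Q\<close> for the law of \<open>\<theta>\<close> with density \<open>r\<close>, \<open>s = q\<^sup>*\<^sub>\<lambda>\<close> with normalising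
  constant \<open>Z\<close>, and \<open>E t\<close> for the mean of \<open>ln f(X, t, Y)\<close>. By Fubini the ELBO is
  \<open>\<integral>E dQ - \<integral>ln q dP - \<integral>ln r dQ\<close>. At \<open>Q\<close>-almost every \<open>t\<close> the mean \<open>E t\<close> is finite, so
  \<open>E t = ln (s t) + ln Z\<close> there and the ELBO is a constant plus \<open>\<integral>(ln s - ln r) dQ\<close>. The last
  term vanishes for \<open>r = s\<close>, and is nonpositive in general since \<open>ln (s / r) \<le> s / r - 1\<close>.
\<close>

section \<open>Extended-real expectations as Bochner integrals\<close>

lemma ext_expectation_eq_integral:
  assumes h: "integrable P h" and gh: "AE z in P. g z = ereal (h z)"
  shows "ext_expectation P g = ereal (\<integral>z. h z \<partial>P)"
proof -
  have "pos_expectation P g = (\<integral>\<^sup>+ z. ennreal (h z) \<partial>P)"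
    unfolding pos_expectation_def using gh by (intro nn_integral_cong_AE) auto
  moreover have "pos_expectation P (\<lambda>z. - g z) = (\<integral>\<^sup>+ z. ennreal (- h z) \<partial>P)"
    unfolding pos_expectation_def using gh by (intro nn_integral_cong_AE) auto
  \<comment> \<open>Both parts are finite, so the \<open>ereal\<close> difference is a difference of
    reals and the convention for \<infinity> - \<infinity> is never met.\<close>
  moreover have "(\<integral>\<^sup>+ z. ennreal (h z) \<partial>P) < \<infinity>" "(\<integral>\<^sup>+ z. ennreal (- h z) \<partial>P) < \<infinity>"
    using h by (auto simp: real_integrable_def less_top)
  moreover have "enn2ereal a = ereal (enn2real a)" if "a < \<infinity>" for a :: ennreal
    using that by (cases a) (auto simp: enn2ereal_ennreal)
  ultimately show ?thesis
    using h by (simp add: ext_expectation_def real_lebesgue_integral_def)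
qed

text \<open>Wherever \<open>u\<close> is not positive, \<open>- elog (u z)\<close> is \<infinity>; a
  finite negative part therefore makes this set null. Off it \<open>elog\<close> is the real
  logarithm, so the two finite parts give integrability.\<close>

lemma expectation_finite_elogD:
  assumes u[measurable]: "u \<in> borel_measurable P"
    and fin: "expectation_finite P (\<lambda>z. elog (u z))"
  shows "AE z in P. 0 < u z" and "integrable P (\<lambda>z. ln (u z))"
proof -
  from fin have [measurable]: "(\<lambda>z. elog (u z)) \<in> borel_measurable P"
    and pos: "(\<integral>\<^sup>+ z. e2ennreal (elog (u z)) \<partial>P) < \<infinity>"
    and neg: "(\<integral>\<^sup>+ z. e2ennreal (- elog (u z)) \<partial>P) < \<infinity>"
    by (auto simp: expectation_finite_def pos_expectation_def)
  have "AE z in P. e2ennreal (- elog (u z)) \<noteq> \<infinity>"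
    using neg by (intro nn_integral_PInf_AE) auto
  then show ae: "AE z in P. 0 < u z"
    by eventually_elim (auto simp: elog_def split: if_splits)
  have "(\<integral>\<^sup>+ z. ennreal (ln (u z)) \<partial>P) = (\<integral>\<^sup>+ z. e2ennreal (elog (u z)) \<partial>P)"
    using ae by (intro nn_integral_cong_AE) (auto simp: elog_def)
  moreover have "(\<integral>\<^sup>+ z. ennreal (- ln (u z)) \<partial>P) = (\<integral>\<^sup>+ z. e2ennreal (- elog (u z)) \<partial>P)"
    using ae by (intro nn_integral_cong_AE) (auto simp: elog_def)
  ultimately show "integrable P (\<lambda>z. ln (u z))"
    using pos neg by (simp add: real_integrable_def less_top)
qed

section \<open>Laws given by densities, their products and marginals\<close>

lemma prob_space_prob_density:
  assumes "prob_density M q"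
  shows "prob_space (density M (\<lambda>x. ennreal (q x)))"
  using assms by (intro prob_spaceI) (auto simp: prob_density_def emeasure_density cong: nn_integral_cong)

lemma distr_pair_snd:
  assumes "prob_space P" and "sigma_finite_measure Q"
  shows "distr (P \<Otimes>\<^sub>M Q) Q snd = Q"
proof (rule measure_eqI)
  interpret P: prob_space P by fact
  interpret Q: sigma_finite_measure Q by fact
  fix A assume "A \<in> sets (distr (P \<Otimes>\<^sub>M Q) Q snd)"
  then have A: "A \<in> sets Q" by simp
  then have "snd -` A \<inter> space (P \<Otimes>\<^sub>M Q) = space P \<times> A"
    using sets.sets_into_space by (fastforce simp: space_pair_measure)
  with A show "emeasure (distr (P \<Otimes>\<^sub>M Q) Q snd) A = emeasure Q A"
    by (simp add: emeasure_distr Q.emeasure_pair_measure_Times P.emeasure_space_1)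
qed simp

text \<open>Nonnegativity lets \<open>ennreal\<close> pass through the product of the two densities.
  Independence of the coordinates then appears as a product measure, to which Fubini
  applies.\<close>

lemma product_law_eq_pair_measure:
  assumes "sigma_finite_measure N" and q: "prob_density M q" and r: "prob_density N r"
  shows "product_law M N q r =
    density M (\<lambda>x. ennreal (q x)) \<Otimes>\<^sub>M density N (\<lambda>t. ennreal (r t))"
proof -
  have [measurable]: "q \<in> borel_measurable M" "r \<in> borel_measurable N"
    using q r by (auto simp: prob_density_def)
  have "product_law M N q r = density (M \<Otimes>\<^sub>M N) (\<lambda>(x, t). ennreal (q x) * ennreal (r t))"
    unfolding product_law_def
    using q r by (intro density_cong) (auto simp: prob_density_def space_pair_measure ennreal_mult')
  also have "\<dots> = density M (\<lambda>x. ennreal (q x)) \<Otimes>\<^sub>M density N (\<lambda>t. ennreal (r t))"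
    using assms(1) prob_space_prob_density[OF r]
    by (intro pair_measure_density[symmetric])
      (auto simp: prob_space_imp_sigma_finite)
  finally show ?thesis .
qed

text \<open>Fubini treats the \<open>g\<close> term, and the marginals treat the two entropy terms.
  The middle conclusion links \<open>E\<close> to the definition of \<open>q*\<close>, which uses
  \<open>ext_expectation\<close>: the two agree at those \<open>t\<close> whose section is
  integrable and positive almost everywhere.\<close>

lemma elbo_decomposition:
  fixes g :: "'x \<Rightarrow> 't \<Rightarrow> real"
  assumes N: "sigma_finite_measure N"
    and g: "(\<lambda>(x, t). g x t) \<in> borel_measurable (M \<Otimes>\<^sub>M N)"
    and q: "prob_density M q" and r: "prob_density N r"
    and fin_g: "expectation_finite (product_law M N q r) (\<lambda>(x, t). elog (g x t))"
    and fin_q: "expectation_finite (density M (\<lambda>x. ennreal (q x))) (\<lambda>x. elog (q x))"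
    and fin_r: "expectation_finite (density N (\<lambda>t. ennreal (r t))) (\<lambda>t. elog (r t))"
  defines "P \<equiv> density M (\<lambda>x. ennreal (q x))" and "Q \<equiv> density N (\<lambda>t. ennreal (r t))"
  defines "E \<equiv> \<lambda>t. \<integral>x. ln (g x t) \<partial>P"
  shows "integrable Q E"
    and "AE t in Q. ext_expectation P (\<lambda>x. elog (g x t)) = ereal (E t)"
    and "elbo M N g q r = ereal ((\<integral>t. E t \<partial>Q) - (\<integral>x. ln (q x) \<partial>P) - (\<integral>t. ln (r t) \<partial>Q))"
proof -
  have [measurable]: "q \<in> borel_measurable M" "r \<in> borel_measurable N"
    using q r by (auto simp: prob_density_def)
  interpret P: prob_space P unfolding P_def by (rule prob_space_prob_density[OF q])
  interpret Q: prob_space Q unfolding Q_def by (rule prob_space_prob_density[OF r])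
  interpret PQ: pair_prob_space P Q ..
  have law: "product_law M N q r = P \<Otimes>\<^sub>M Q"
    unfolding P_def Q_def by (rule product_law_eq_pair_measure[OF N q r])
  have [measurable_cong]: "sets P = sets M" "sets Q = sets N" by (auto simp: P_def Q_def)
  note g[measurable]
  have g': "(\<lambda>z. g (fst z) (snd z)) \<in> borel_measurable (P \<Otimes>\<^sub>M Q)" by measurable
  have "expectation_finite (P \<Otimes>\<^sub>M Q) (\<lambda>z. elog (g (fst z) (snd z)))"
    using fin_g by (simp add: law case_prod_beta')
  note g_PQ = expectation_finite_elogD[OF g' this]
  have int_g: "integrable (P \<Otimes>\<^sub>M Q) (\<lambda>(x, t). ln (g x t))"
    using g_PQ(2) by (simp add: case_prod_beta')
  show "integrable Q E" unfolding E_def by (rule PQ.integrable_snd[OF int_g])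
  have EQ: "(\<integral>t. E t \<partial>Q) = (\<integral>z. ln (g (fst z) (snd z)) \<partial>(P \<Otimes>\<^sub>M Q))"
    unfolding E_def using PQ.integral_snd[OF int_g] by (simp add: case_prod_beta')

  \<comment> \<open>Positivity on pairs is first iterated with \<open>t\<close> inside; the sections
    at fixed \<open>t\<close> need the other order of the quantifiers.\<close>
  have "AE x in P. AE t in Q. 0 < g x t"
    using PQ.AE_pair[OF g_PQ(1)] by simp
  then have "AE t in Q. AE x in P. 0 < g x t"
    by (subst (asm) PQ.AE_commute) measurable
  with PQ.AE_integrable_snd[OF int_g]
  show "AE t in Q. ext_expectation P (\<lambda>x. elog (g x t)) = ereal (E t)"
  proof eventually_elim
    case (elim t)
    from elim(2) have "AE x in P. elog (g x t) = ereal (ln (g x t))"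
      by eventually_elim (simp add: elog_def)
    with elim(1) show ?case
      unfolding E_def by (rule ext_expectation_eq_integral)
  qed

  have int_q: "integrable P (\<lambda>x. ln (q x))"
    unfolding P_def by (rule expectation_finite_elogD(2)[OF _ fin_q]) measurable
  have int_r: "integrable Q (\<lambda>t. ln (r t))"
    unfolding Q_def by (rule expectation_finite_elogD(2)[OF _ fin_r]) measurable
  \<comment> \<open>The marginals carry integrals of functions of one coordinate between the product
    and its factors.\<close>
  have dfst: "distr (P \<Otimes>\<^sub>M Q) P fst = P" by (rule Q.distr_pair_fst)
  have dsnd: "distr (P \<Otimes>\<^sub>M Q) Q snd = Q"
    by (rule distr_pair_snd) unfold_locales
  have q_PQ: "integrable (P \<Otimes>\<^sub>M Q) (\<lambda>z. ln (q (fst z)))"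
    "(\<integral>z. ln (q (fst z)) \<partial>(P \<Otimes>\<^sub>M Q)) = (\<integral>x. ln (q x) \<partial>P)"
    using int_q integrable_distr[of fst "P \<Otimes>\<^sub>M Q" P "\<lambda>x. ln (q x)"]
      integral_distr[of fst "P \<Otimes>\<^sub>M Q" P "\<lambda>x. ln (q x)"] by (simp_all add: dfst)
  have r_PQ: "integrable (P \<Otimes>\<^sub>M Q) (\<lambda>z. ln (r (snd z)))"
    "(\<integral>z. ln (r (snd z)) \<partial>(P \<Otimes>\<^sub>M Q)) = (\<integral>t. ln (r t) \<partial>Q)"
    using int_r integrable_distr[of snd "P \<Otimes>\<^sub>M Q" Q "\<lambda>x. ln (r x)"]
      integral_distr[of snd "P \<Otimes>\<^sub>M Q" Q "\<lambda>x. ln (r x)"] by (simp_all add: dsnd)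
  \<comment> \<open>Only points of positive joint density count, and there both nonnegative factors
    are positive. With \<open>g\<close> positive too, the logarithm of the ratio splits without
    meeting \<open>ln 0\<close> or a zero denominator.\<close>
  have "AE z in M \<Otimes>\<^sub>M N. 0 < ennreal (q (fst z) * r (snd z)) \<longrightarrow> 0 < q (fst z) \<and> 0 < r (snd z)"
    using q r by (intro AE_I2) (auto simp: prob_density_def space_pair_measure zero_less_mult_iff dest: leD)
  then have "AE z in P \<Otimes>\<^sub>M Q. 0 < q (fst z) \<and> 0 < r (snd z)"
    unfolding law[symmetric] product_law_def by (subst AE_density) (auto simp: case_prod_beta')
  with g_PQ(1) have "AE z in P \<Otimes>\<^sub>M Q. (case z of (x, t) \<Rightarrow> elog (g x t / (q x * r t))) =
      ereal (ln (g (fst z) (snd z)) - ln (q (fst z)) - ln (r (snd z)))"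
    by eventually_elim (auto simp: elog_def ln_div ln_mult split_beta)
  then have "elbo M N g q r =
      ereal (\<integral>z. ln (g (fst z) (snd z)) - ln (q (fst z)) - ln (r (snd z)) \<partial>(P \<Otimes>\<^sub>M Q))"
    unfolding elbo_def law using g_PQ(2) q_PQ(1) r_PQ(1)
    by (intro ext_expectation_eq_integral) auto
  then show "elbo M N g q r =
      ereal ((\<integral>t. E t \<partial>Q) - (\<integral>x. ln (q x) \<partial>P) - (\<integral>t. ln (r t) \<partial>Q))"
    using g_PQ(2) q_PQ r_PQ EQ by simp
qed

text \<open>Gibbs' inequality: the integral is minus the Kullback-Leibler divergence of
  \<open>r\<close> from \<open>s\<close>. It follows by integrating
  \<open>ln a - ln b \<le> a / b - 1\<close>, since the mean of \<open>s / r\<close> under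
  \<open>Q\<close> is at most 1.\<close>

lemma integral_ln_diff_nonpos:
  assumes r: "prob_density N r" and s: "prob_density N s"
  defines "Q \<equiv> density N (\<lambda>t. ennreal (r t))"
  assumes s_pos: "AE t in Q. 0 < s t" and int: "integrable Q (\<lambda>t. ln (s t) - ln (r t))"
  shows "(\<integral>t. ln (s t) - ln (r t) \<partial>Q) \<le> 0"
proof -
  have [measurable]: "r \<in> borel_measurable N" "s \<in> borel_measurable N"
    and r0: "\<And>t. t \<in> space N \<Longrightarrow> 0 \<le> r t" and s0: "\<And>t. t \<in> space N \<Longrightarrow> 0 \<le> s t"
    and s1: "(\<integral>\<^sup>+ t. ennreal (s t) \<partial>N) = 1"
    using r s by (auto simp: prob_density_def)
  interpret Q: prob_space Q unfolding Q_def by (rule prob_space_prob_density[OF r])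
  have int_s: "integrable N s"
    using s1 s0 by (intro integrableI_nonneg) auto
  have "(\<integral>t. s t \<partial>N) = 1"
    using s1 s0 by (subst integral_eq_nn_integral) auto
  \<comment> \<open>The product is \<open>s t\<close> where \<open>r t > 0\<close> and 0 where
    \<open>r t = 0\<close>, so it is dominated by \<open>s\<close>. Mass of \<open>s\<close> outside
    the support of \<open>r\<close> is lost, hence an inequality below rather than an
    equality.\<close>
  have int_rs: "integrable N (\<lambda>t. r t * (s t / r t))"
    using r0 s0 by (intro Bochner_Integration.integrable_bound[OF int_s]) auto
  have int_Q: "integrable Q (\<lambda>t. s t / r t)"
    unfolding Q_def using r0 int_rs by (subst integrable_density) auto
  have "(\<integral>t. s t / r t \<partial>Q) = (\<integral>t. r t * (s t / r t) \<partial>N)"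
    unfolding Q_def using r0 by (subst integral_density) auto
  also have "\<dots> \<le> (\<integral>t. s t \<partial>N)"
    using s0 by (intro integral_mono[OF int_rs int_s]) auto
  finally have le: "(\<integral>t. s t / r t \<partial>Q) \<le> 1" using \<open>(\<integral>t. s t \<partial>N) = 1\<close> by simp
  have "AE t in Q. 0 < r t"
    unfolding Q_def by (subst AE_density) auto
  with s_pos have "AE t in Q. ln (s t) - ln (r t) \<le> s t / r t - 1"
    by eventually_elim (metis diff_divide_distrib divide_self ln_diff_le less_irrefl)
  then have "(\<integral>t. ln (s t) - ln (r t) \<partial>Q) \<le> (\<integral>t. s t / r t - 1 \<partial>Q)"
    using int int_Q by (intro integral_mono_AE) auto
  also have "\<dots> \<le> 0" using int_Q le by (simp add: Q.prob_space)
  finally show ?thesis .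
qed

text \<open>An \<open>N\<close>-null set of \<open>t\<close> lifts to a null set of pairs, so
  neither the law nor the integrand changes essentially. This is needed because the family member at
  \<rho>*(\<lambda>) equals \<open>q*\<close> only almost everywhere.\<close>

lemma elbo_cong_AE:
  assumes "sigma_finite_measure M" and "sigma_finite_measure N"
    and [measurable]: "q \<in> borel_measurable M" "r \<in> borel_measurable N" "s \<in> borel_measurable N"
    and rs: "AE t in N. r t = s t"
  shows "elbo M N g q r = elbo M N g q s"
proof -
  interpret M: sigma_finite_measure M by fact
  interpret N: sigma_finite_measure N by fact
  interpret MN: pair_sigma_finite M N ..
  have rs': "AE z in M \<Otimes>\<^sub>M N. r (snd z) = s (snd z)"
  proof (rule MN.AE_pair_measure)
    show "{z \<in> space (M \<Otimes>\<^sub>M N). r (snd z) = s (snd z)} \<in> sets (M \<Otimes>\<^sub>M N)" by measurable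
  qed (use rs in simp)
  have law: "product_law M N q r = product_law M N q s"
    unfolding product_law_def
    by (rule density_cong) (use rs' in \<open>auto simp: case_prod_beta'\<close>)
  have "AE z in product_law M N q s. r (snd z) = s (snd z)"
    unfolding product_law_def by (subst AE_density) (use rs' in auto)
  then have "pos_expectation (product_law M N q s) (\<lambda>(x, t). elog (g x t / (q x * r t))) =
      pos_expectation (product_law M N q s) (\<lambda>(x, t). elog (g x t / (q x * s t)))"
    "pos_expectation (product_law M N q s) (\<lambda>z. - (case z of (x, t) \<Rightarrow> elog (g x t / (q x * r t)))) =
      pos_expectation (product_law M N q s) (\<lambda>z. - (case z of (x, t) \<Rightarrow> elog (g x t / (q x * s t))))"
    unfolding pos_expectation_def
    by (auto intro!: nn_integral_cong_AE simp: split_beta)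
  then show ?thesis
    by (simp add: elbo_def law ext_expectation_def)
qed

section \<open>The gap between the fixed-form ELBO and its maximum over \<rho>\<close>

theorem mainTheorem2:
  fixes M :: "'x measure" and N :: "'t measure"
    and f :: "'x \<Rightarrow> 't \<Rightarrow> 'y \<Rightarrow> real" and y :: 'y
    and \<Lambda> :: "'l::euclidean_space set" and R :: "'r::euclidean_space set"
    and qX :: "'l \<Rightarrow> 'x \<Rightarrow> real" and q\<theta> :: "'r \<Rightarrow> 't \<Rightarrow> real"
    and \<rho>star :: "'l \<Rightarrow> 'r"
  assumes "sigma_finite_measure M" and "sigma_finite_measure N"
    and f_nonneg: "\<And>x t. x \<in> space M \<Longrightarrow> t \<in> space N \<Longrightarrow> 0 \<le> f x t y"
    and f_meas: "(\<lambda>(x, t). f x t y) \<in> borel_measurable (M \<Otimes>\<^sub>M N)"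
    and f_normalisable: "normalisable (M \<Otimes>\<^sub>M N) (\<lambda>(x, t). ennreal (f x t y))"
    and qX_density: "\<And>l. l \<in> \<Lambda> \<Longrightarrow> prob_density M (qX l)"
    and q\<theta>_density: "\<And>\<rho>. \<rho> \<in> R \<Longrightarrow> prob_density N (q\<theta> \<rho>)"
    and qstar_defined: "\<And>l. l \<in> \<Lambda> \<Longrightarrow>
          AE t in N. expectation_defined (density M (\<lambda>x. ennreal (qX l x))) (\<lambda>x. elog (f x t y))"
    and qstar_normalisable: "\<And>l. l \<in> \<Lambda> \<Longrightarrow> normalisable N (qstar_unnorm M f y qX l)"
    and \<rho>star_mem: "\<And>l. l \<in> \<Lambda> \<Longrightarrow> \<rho>star l \<in> R"
    and \<rho>star_eq: "\<And>l. l \<in> \<Lambda> \<Longrightarrow> AE t in N. q\<theta> (\<rho>star l) t = qstar M N f y qX l t"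
    and finite_f: "\<And>l \<rho>. l \<in> \<Lambda> \<Longrightarrow> \<rho> \<in> R \<Longrightarrow>
          expectation_finite (product_law M N (qX l) (q\<theta> \<rho>)) (\<lambda>(x, t). elog (f x t y))"
    and finite_qX: "\<And>l. l \<in> \<Lambda> \<Longrightarrow>
          expectation_finite (density M (\<lambda>x. ennreal (qX l x))) (\<lambda>x. elog (qX l x))"
    and finite_q\<theta>: "\<And>\<rho>. \<rho> \<in> R \<Longrightarrow>
          expectation_finite (density N (\<lambda>t. ennreal (q\<theta> \<rho> t))) (\<lambda>t. elog (q\<theta> \<rho> t))"
  shows "\<forall>l\<in>\<Lambda>.
      lm_elbo M N f y qX l = fixed_form_elbo M N f y qX q\<theta> l (\<rho>star l) \<and>
      is_maximum {fixed_form_elbo M N f y qX q\<theta> l \<rho> | \<rho>. \<rho> \<in> R} (lm_elbo M N f y qX l)"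
proof (intro ballI)
  fix l assume l: "l \<in> \<Lambda>"
  define P where "P = density M (\<lambda>x. ennreal (qX l x))"
  define u where "u = qstar_unnorm M f y qX l"
  define Z where "Z = enn2real (\<integral>\<^sup>+ t. u t \<partial>N)"
  \<comment> \<open>This representative of \<open>q*\<close> is a probability density by hypothesis;
    the formula for \<open>q*\<close> is recovered almost everywhere in \<open>s_eq\<close>.\<close>
  define s where "s = q\<theta> (\<rho>star l)"
  have u_meas[measurable]: "u \<in> borel_measurable N"
    and Z: "(\<integral>\<^sup>+ t. u t \<partial>N) = ennreal Z" "0 < Z"
    using qstar_normalisable[OF l]
    by (auto simp: normalisable_def u_def Z_def enn2real_positive_iff less_top)
  have qstar: "qstar M N f y qX l = (\<lambda>t. enn2real (u t / ennreal Z))"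
    by (auto simp: qstar_def u_def[symmetric] Z(1))
  have s: "prob_density N s" using q\<theta>_density \<rho>star_mem[OF l] by (simp add: s_def)
  have s_eq: "AE t in N. s t = enn2real (u t / ennreal Z)"
    using \<rho>star_eq[OF l] by (simp add: s_def qstar)
  have [measurable]: "qX l \<in> borel_measurable M" "s \<in> borel_measurable N"
    using qX_density[OF l] s by (auto simp: prob_density_def)
  have lm: "lm_elbo M N f y qX l = fixed_form_elbo M N f y qX q\<theta> l (\<rho>star l)"
    unfolding lm_elbo_def fixed_form_elbo_def s_def[symmetric] qstar
    using assms(1,2) s_eq by (intro elbo_cong_AE) auto

  \<comment> \<open>\<open>K\<close> collects the terms free of \<rho> once \<open>E\<close> is
    replaced by \<open>ln s + ln Z\<close>; it will be the maximum. The remainder \<open>D\<close>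
    below is minus the divergence of the member at \<rho> from \<open>s\<close>.\<close>
  define K where "K = ln Z - (\<integral>x. ln (qX l x) \<partial>P)"
  have elbo_gap: "\<exists>D. fixed_form_elbo M N f y qX q\<theta> l \<rho> = ereal (K + D) \<and> D \<le> 0 \<and> (\<rho> = \<rho>star l \<longrightarrow> D = 0)"
    if \<rho>: "\<rho> \<in> R" for \<rho>
  proof -
    define r where "r = q\<theta> \<rho>"
    define Q where "Q = density N (\<lambda>t. ennreal (r t))"
    define E where "E = (\<lambda>t. \<integral>x. ln (f x t y) \<partial>P)"
    have r: "prob_density N r" using q\<theta>_density[OF \<rho>] by (simp add: r_def)
    then have [measurable]: "r \<in> borel_measurable N" by (simp add: prob_density_def)
    interpret Q: prob_space Q unfolding Q_def by (rule prob_space_prob_density[OF r])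
    note decomp = elbo_decomposition[OF assms(2) f_meas qX_density[OF l] r
        finite_f[OF l \<rho>, folded r_def] finite_qX[OF l] finite_q\<theta>[OF \<rho>, folded r_def],
        folded P_def Q_def, folded E_def]
    have "AE t in Q. s t = enn2real (u t / ennreal Z)"
      unfolding Q_def by (subst AE_density) (use s_eq in auto)
    \<comment> \<open>A finite expectation selects the real branch of \<open>eexp\<close>, so
      \<open>s\<close> is positive \<open>Q\<close>-almost everywhere. Since \<open>finite_f\<close>
      covers every \<rho>, this yields the positivity of \<open>s\<close> that Gibbs' inequality
      requires for every competitor.\<close>
    with decomp(2) have "AE t in Q. s t = exp (E t) / Z"
    proof eventually_elim
      case (elim t)
      then have "u t = ennreal (exp (E t))"
        by (simp add: u_def qstar_unnorm_def P_def E_def eexp_def)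
      with elim(2) \<open>0 < Z\<close> show ?case by (simp add: divide_ennreal)
    qed
    then have sE: "AE t in Q. 0 < s t \<and> E t = ln (s t) + ln Z"
    proof eventually_elim
      case (elim t)
      with \<open>0 < Z\<close> show ?case by (simp add: ln_div)
    qed
    have int_r: "integrable Q (\<lambda>t. ln (r t))"
      using expectation_finite_elogD(2)[OF _ finite_q\<theta>[OF \<rho>]] by (simp add: Q_def r_def[symmetric])
    \<comment> \<open>\<open>finite_q\<theta>\<close> controls \<open>ln s\<close> only under the
      law of \<open>s\<close> itself; integrability under \<open>Q\<close> is inherited from
      \<open>E\<close>.\<close>
    have "integrable Q (\<lambda>t. E t - ln Z)" using decomp(1) by simp
    moreover have "AE t in Q. E t - ln Z = ln (s t)" using sE by auto
    moreover have "(\<lambda>t. ln (s t)) \<in> borel_measurable Q" unfolding Q_def by measurable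
    ultimately have int_s: "integrable Q (\<lambda>t. ln (s t))"
      using integrable_cong_AE_imp by blast
    define D where "D = (\<integral>t. ln (s t) - ln (r t) \<partial>Q)"
    have "(\<integral>t. E t \<partial>Q) = (\<integral>t. ln (s t) + ln Z \<partial>Q)"
      using sE decomp(1) int_s by (intro integral_cong_AE) auto
    also have "\<dots> = (\<integral>t. ln (s t) \<partial>Q) + ln Z"
      using int_s by (simp add: Q.prob_space)
    finally have "fixed_form_elbo M N f y qX q\<theta> l \<rho> = ereal (K + D)"
      using decomp(3) int_s int_r by (simp add: fixed_form_elbo_def r_def[symmetric] K_def D_def)
    moreover have "D \<le> 0"
      unfolding D_def
      by (rule integral_ln_diff_nonpos[OF r s, folded Q_def]) (use sE int_s int_r in auto)
    moreover have "D = 0" if "\<rho> = \<rho>star l"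
      using that by (simp add: D_def r_def s_def)
    ultimately show ?thesis by blast
  qed
  \<comment> \<open>The left side is \<open>K + D\<close> with \<open>D \<le> 0\<close>, and the
    right side is \<open>K\<close>.\<close>
  have "fixed_form_elbo M N f y qX q\<theta> l \<rho> \<le> fixed_form_elbo M N f y qX q\<theta> l (\<rho>star l)"
    if "\<rho> \<in> R" for \<rho>
    using elbo_gap[OF that] elbo_gap[OF \<rho>star_mem[OF l]] by auto
  with \<rho>star_mem[OF l] lm
  show "lm_elbo M N f y qX l = fixed_form_elbo M N f y qX q\<theta> l (\<rho>star l) \<and>
      is_maximum {fixed_form_elbo M N f y qX q\<theta> l \<rho> | \<rho>. \<rho> \<in> R} (lm_elbo M N f y qX l)"
    by (auto simp: is_maximum_def)
qed

end
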